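(* Let $D$ be a commutative ring and let $A$ be a free finite dimensional associative algebra over $D$. Let $\overline{\overline{I}}=\{I_k\}$ be a basis of $\mathcal{L}(A;A)$, understood as a basis of the representation of $A\otimes A$ in $\mathcal{L}(A;A)$, and let $\overline{\overline{e}}=\{\overline{e}_i\}$ be a basis of the algebra $A$ over $D$. Then the standard representation of a polylinear ($n$-linear) mapping $f:A^n\to A$ has the form $$f\circ(a_1,\dots,a_n)=f^{i_0\dots i_n}_{t\cdot k_1\dots k_n}\;\overline{e}_{i_0}\;\sigma_t(I_{k_1}\circ a_1)\;\overline{e}_{i_1}\;\cdots\;\sigma_t(I_{k_n}\circ a_n)\;\overline{e}_{i_n}$$ (summation over the repeated indices $t$, $k_1,\dots,k_n$, $i_0,\dots,i_n$ is understood), where the index $t$ enumerates all possible permutations $\sigma_t$ of the set of variables $\{a_1,\dots,a_n\}$ and $f^{i_0\dots i_n}_{t\cdot k_1\dots k_n}\in D$. The expression $f^{i_0\dots i_n}_{t\cdot k_1\dots k_n}$ is called a standard component of the polylinear mapping $f$.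
   Context: A $D$-algebra is a $D$-module equipped with a $D$-bilinear product; it is free if it is free as a $D$-module, and free finite dimensional if moreover it has a finite basis. $f\circ x$ denotes the value of $f$ at $x$. A mapping is polylinear ($n$-linear) if it is additive and $D$-homogeneous in each of its $n$ arguments. $\mathcal{L}(A;A)$ is the $D$-module of $D$-linear mappings $A\to A$. The algebra $A\otimes A$ (over $D$), with product $(c\otimes d)\circ(a\otimes b)=(ca)\otimes(bd)$, is represented in $\mathcal{L}(A;A)$ by $((a\otimes b)\circ g)\circ x=a\,(g\circ x)\,b$. A basis of this representation is a minimal set $\{I_k\}\subset\mathcal{L}(A;A)$ such that every $g\in\mathcal{L}(A;A)$ is a finite sum of mappings of the form $x\mapsto a\,(I_k\circ x)\,b$ with $a,b\in A$. In $\sigma_t(I_{k_m}\circ a_m)$ the convention is that the mapping $I_{k_j}$ always has the variable $a_j$ as its argument, and $\sigma_t$ prescribes the order of the factors: regarding $\sigma_t$ as a permutation of $\{1,\dots,n\}$, $\sigma_t(I_{k_m}\circ a_m)$ means $I_{k_{\sigma_t(m)}}\circ a_{\sigma_t(m)}$. *)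

theory Defs
  imports Complex_Main "HOL-Library.FuncSet" "HOL-Combinatorics.Permutations"
begin

text \<open>
  An associative algebra \<open>A\<close> (the type \<open>'a\<close>, not assumed to be unital or commutative) over the
  commutative ring \<open>D\<close> (the type \<open>'d\<close>).
\<close>

locale assoc_algebra = module scale
  for scale :: "'d::comm_ring_1 \<Rightarrow> 'a::ring \<Rightarrow> 'a" (infixr \<open>*s\<close> 75) +
  assumes scale_mult_left: "r *s (x * y) = (r *s x) * y"
    and scale_mult_right: "r *s (x * y) = x * (r *s y)"
begin

definition is_basis :: "'a set \<Rightarrow> bool" where
  "is_basis B \<longleftrightarrow> independent B \<and> span B = UNIV"

definition free_finite_dimensional :: bool where
  "free_finite_dimensional \<longleftrightarrow> (\<exists>B. finite B \<and> is_basis B)"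

definition linear_maps :: "('a \<Rightarrow> 'a) set" where
  "linear_maps = {g. module_hom (*s) (*s) g}"

text \<open>
  A finite sum of mappings \<open>x \<mapsto> a (h x) b\<close> with \<open>h \<in> H\<close> is the action of elements of
  \<open>A \<otimes> A\<close> on elements of \<open>H\<close>; it is given by the list of its triples \<open>(a, h, b)\<close>, so
  that one \<open>h\<close> may occur in several summands.
\<close>

definition generates_linear_maps :: "('a \<Rightarrow> 'a) set \<Rightarrow> bool" where
  "generates_linear_maps H \<longleftrightarrow>
     (\<forall>g\<in>linear_maps. \<exists>ts :: ('a \<times> ('a \<Rightarrow> 'a) \<times> 'a) list.
        (\<forall>(a, h, b)\<in>set ts. h \<in> H) \<and>
        (\<forall>x. g x = (\<Sum>(a, h, b)\<leftarrow>ts. a * h x * b)))"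

definition is_representation_basis :: "('a \<Rightarrow> 'a) set \<Rightarrow> bool" where
  "is_representation_basis H \<longleftrightarrow>
     H \<subseteq> linear_maps \<and> generates_linear_maps H \<and> (\<forall>H'. H' \<subset> H \<longrightarrow> \<not> generates_linear_maps H')"

text \<open>
  \<open>A\<^sup>n\<close> is the set \<open>{1..n} \<rightarrow>\<^sub>E UNIV\<close>; the values of \<open>f\<close> outside this set are irrelevant.
\<close>

definition polylinear :: "nat \<Rightarrow> ((nat \<Rightarrow> 'a) \<Rightarrow> 'a) \<Rightarrow> bool" where
  "polylinear n f \<longleftrightarrow>
     (\<forall>a \<in> {1..n} \<rightarrow>\<^sub>E UNIV. \<forall>m\<in>{1..n}. (\<lambda>x. f (a(m := x))) \<in> linear_maps)"

text \<open>\<open>alternating_product u v n\<close> is \<open>u 0 * v 1 * u 1 * v 2 * u 2 * \<dots> * v n * u n\<close>.\<close>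

primrec alternating_product :: "(nat \<Rightarrow> 'a) \<Rightarrow> (nat \<Rightarrow> 'a) \<Rightarrow> nat \<Rightarrow> 'a" where
  "alternating_product u v 0 = u 0"
| "alternating_product u v (Suc m) = alternating_product u v m * v (Suc m) * u (Suc m)"

text \<open>
  The families \<open>I\<close> and \<open>e\<close> are indexed by the sets \<open>K\<close> and \<open>N\<close>. A triple \<open>(\<sigma>, k, i)\<close> below
  consists of a permutation of \<open>{1..n}\<close> and of the multi-indices \<open>k\<^sub>1, \<dots>, k\<^sub>n\<close> and
  \<open>i\<^sub>0, \<dots>, i\<^sub>n\<close>.
\<close>

definition component_indices ::
    "nat \<Rightarrow> 'k set \<Rightarrow> 'i set \<Rightarrow> ((nat \<Rightarrow> nat) \<times> (nat \<Rightarrow> 'k) \<times> (nat \<Rightarrow> 'i)) set" where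
  "component_indices n K N = {\<sigma>. \<sigma> permutes {1..n}} \<times> ({1..n} \<rightarrow>\<^sub>E K) \<times> ({0..n} \<rightarrow>\<^sub>E N)"

text \<open>
  The components \<open>c\<close> are required to have finite support and the sum extends over that support, so
  that no finiteness of \<open>K\<close> or \<open>N\<close> is presupposed; for finite \<open>K\<close> and \<open>N\<close> this is the sum over
  all indices. As \<open>\<sigma>\<close> moves \<open>I\<^sub>k\<close> together with its argument, the \<open>m\<close>-th mapping factor is
  \<open>I (k (\<sigma> m)) (a (\<sigma> m))\<close>.
\<close>

definition standard_representation ::
    "nat \<Rightarrow> ('k \<Rightarrow> 'a \<Rightarrow> 'a) \<Rightarrow> 'k set \<Rightarrow> ('i \<Rightarrow> 'a) \<Rightarrow> 'i set \<Rightarrow> ((nat \<Rightarrow> 'a) \<Rightarrow> 'a)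
      \<Rightarrow> ((nat \<Rightarrow> nat) \<Rightarrow> (nat \<Rightarrow> 'k) \<Rightarrow> (nat \<Rightarrow> 'i) \<Rightarrow> 'd) \<Rightarrow> bool" where
  "standard_representation n I K e N f c \<longleftrightarrow>
     finite {(\<sigma>, k, i) \<in> component_indices n K N. c \<sigma> k i \<noteq> 0} \<and>
     (\<forall>a \<in> {1..n} \<rightarrow>\<^sub>E UNIV.
        f a = (\<Sum>(\<sigma>, k, i) \<in> {(\<sigma>, k, i) \<in> component_indices n K N. c \<sigma> k i \<noteq> 0}.
                 c \<sigma> k i *s
                 alternating_product (\<lambda>j. e (i j)) (\<lambda>m. I (k (\<sigma> m)) (a (\<sigma> m))) n))"

end

end

theory Submission
  imports Defs "HOL-Library.Function_Algebras"
begin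

text \<open>
  Expanding \<open>f\<close> in its last argument along a finite basis \<open>B\<close> with coordinate functionals \<open>\<phi>\<^sub>b\<close> gives
  \<open>f(a\<^sub>1, \<dots>, a\<^sub>n\<^sub>+\<^sub>1) = \<Sum>\<^sub>b \<phi>\<^sub>b(a\<^sub>n\<^sub>+\<^sub>1) f(a\<^sub>1, \<dots>, a\<^sub>n, b)\<close>. By induction each \<open>f(a\<^sub>1, \<dots>, a\<^sub>n, b)\<close> is a
  combination of products \<open>M e\<^sub>i\<close> ending in a basis element, and \<open>x \<mapsto> \<phi>\<^sub>b(x) e\<^sub>i\<close> is again a linear
  mapping, hence a finite sum of mappings \<open>x \<mapsto> p (I\<^sub>k x) q\<close>; substituting it extends the product
  by one factor. Only the identity permutation is needed.
\<close>

section \<open>Products in the order of the identity permutation, and their span\<close>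

locale generated_assoc_algebra = assoc_algebra scale
  for scale :: "'d::comm_ring_1 \<Rightarrow> 'a::ring \<Rightarrow> 'a" (infixr \<open>*s\<close> 75) +
  fixes I :: "'k \<Rightarrow> 'a \<Rightarrow> 'a" and K :: "'k set"
    and e :: "'i \<Rightarrow> 'a" and N :: "'i set"
  assumes generates: "generates_linear_maps (I ` K)"
    and span_e: "span (e ` N) = UNIV"
begin

sublocale pointwise: module "\<lambda>r (F :: (nat \<Rightarrow> 'a) \<Rightarrow> 'a) a. r *s F a"
  by standard (simp_all add: fun_eq_iff scale_right_distrib scale_left_distrib)

definition monomial :: "nat \<Rightarrow> (nat \<Rightarrow> 'k) \<Rightarrow> (nat \<Rightarrow> 'i) \<Rightarrow> (nat \<Rightarrow> 'a) \<Rightarrow> 'a" where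
  "monomial n k i a = alternating_product (\<lambda>j. e (i j)) (\<lambda>m. I (k m) (a m)) n"

definition monomials :: "nat \<Rightarrow> ((nat \<Rightarrow> 'a) \<Rightarrow> 'a) set" where
  "monomials n = (\<lambda>(k, i). monomial n k i) ` (({1..n} \<rightarrow>\<^sub>E K) \<times> ({0..n} \<rightarrow>\<^sub>E N))"

text \<open>Its members are functions of all sequences, so membership is plain equality of
  functions; their values depend only on the entries at \<open>1, ..., n\<close>.\<close>

definition standard_maps :: "nat \<Rightarrow> ((nat \<Rightarrow> 'a) \<Rightarrow> 'a) set" where
  "standard_maps n = pointwise.span (monomials n)"

lemma alternating_product_cong:
  assumes "\<And>j. j \<le> n \<Longrightarrow> u j = u' j" "\<And>m. 1 \<le> m \<Longrightarrow> m \<le> n \<Longrightarrow> v m = v' m"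
  shows "alternating_product u v n = alternating_product u' v' n"
  using assms by (induction n) auto

text \<open>The coefficient \<open>u n\<close> occurs only as the rightmost factor, so linearity is
  distributivity there. This lets sums and scalars pass through the last coefficient.\<close>

lemma module_hom_alternating_product_last:
  "module_hom (*s) (*s) (\<lambda>y. alternating_product (u(n := y)) v n)"
proof (cases n)
  case 0
  then show ?thesis by (simp add: module_hom_ident)
next
  case (Suc m)
  have "alternating_product (u(n := y)) v m = alternating_product u v m" for y
    using Suc by (intro alternating_product_cong) auto
  then show ?thesis
    unfolding Suc module_hom_iff
    by (simp add: module_axioms distrib_left scale_mult_right)
qed

lemma standard_maps_zero: "(\<lambda>a. 0) \<in> standard_maps n"
  using pointwise.span_zero[of "monomials n"] unfolding standard_maps_def by (simp add: zero_fun_def)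

lemma standard_maps_add:
  "F \<in> standard_maps n \<Longrightarrow> G \<in> standard_maps n \<Longrightarrow> (\<lambda>a. F a + G a) \<in> standard_maps n"
  using pointwise.span_add[of F "monomials n" G] unfolding standard_maps_def by (simp add: plus_fun_def)

lemma standard_maps_scale: "F \<in> standard_maps n \<Longrightarrow> (\<lambda>a. r *s F a) \<in> standard_maps n"
  unfolding standard_maps_def by (rule pointwise.span_scale)

lemma standard_maps_sum:
  assumes "\<And>b. b \<in> B \<Longrightarrow> F b \<in> standard_maps n"
  shows "(\<lambda>a. \<Sum>b\<in>B. F b a) \<in> standard_maps n"
  using assms
  by (induction B rule: infinite_finite_induct) (auto intro: standard_maps_zero standard_maps_add)

lemma standard_maps_induct [consumes 1, case_names zero add scale monomial]:
  assumes "F \<in> standard_maps n"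
    and "P (\<lambda>a. 0)" and "\<And>F G. P F \<Longrightarrow> P G \<Longrightarrow> P (\<lambda>a. F a + G a)"
    and "\<And>r F. P F \<Longrightarrow> P (\<lambda>a. r *s F a)"
    and "\<And>k i. k \<in> {1..n} \<rightarrow>\<^sub>E K \<Longrightarrow> i \<in> {0..n} \<rightarrow>\<^sub>E N \<Longrightarrow> P (monomial n k i)"
  shows "P F"
  using assms(1) unfolding standard_maps_def
proof (induction rule: pointwise.span_induct)
  case base
  show ?case
    by (rule pointwise.subspaceI) (auto simp: zero_fun_def plus_fun_def intro: assms)
next
  case (step F)
  then show ?case by (auto simp: monomials_def simp del: One_nat_def intro: assms)
qed

section \<open>Building members of the span one factor at a time\<close>

lemma monomial_in_standard_maps:
  assumes "k \<in> {1..n} \<rightarrow>\<^sub>E K" "i \<in> {0..n} \<rightarrow>\<^sub>E N"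
  shows "monomial n k i \<in> standard_maps n"
  using assms unfolding standard_maps_def monomials_def by (intro pointwise.span_base) auto

lemma const_in_standard_maps: "(\<lambda>a. u) \<in> standard_maps 0"
proof -
  have "u \<in> span (e ` N)" by (simp add: span_e)
  then show ?thesis
  proof (induction rule: span_induct)
    case base
    show ?case by (rule subspaceI) (auto intro: standard_maps_zero standard_maps_add standard_maps_scale)
  next
    case (step x)
    then obtain i where i: "i \<in> N" "x = e i" by auto
    \<comment> \<open>The constant \<open>undefined\<close> function is the only element of
      \<open>{1..0} \<rightarrow>\<^sub>E K\<close>.\<close>
    have "monomial 0 (\<lambda>_. undefined) (\<lambda>j\<in>{0..0}. i) \<in> standard_maps 0"
      using i by (intro monomial_in_standard_maps) auto
    also have "monomial 0 (\<lambda>_. undefined) (\<lambda>j\<in>{0..0}. i) = (\<lambda>a. x)"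
      by (simp add: monomial_def i fun_eq_iff)
    finally show ?case .
  qed
qed

text \<open>The product is linear in \<open>u\<close> and in \<open>F\<close>, so \<open>u\<close>
  may be taken to be some \<open>e i0\<close> and \<open>F\<close> a monomial; the result is then a
  monomial with one more factor.\<close>

lemma standard_maps_extend:
  assumes F: "F \<in> standard_maps n" and k0: "k0 \<in> K"
  shows "(\<lambda>a. F a * I k0 (a (Suc n)) * u) \<in> standard_maps (Suc n)"
proof -
  have "u \<in> span (e ` N)" by (simp add: span_e)
  then show ?thesis
  proof (induction rule: span_induct)
    case base
    show ?case
      by (rule subspaceI)
        (auto simp: distrib_left scale_mult_right[symmetric]
          intro: standard_maps_zero standard_maps_add standard_maps_scale)
  next
    case (step x)
    then obtain i0 where i0: "i0 \<in> N" "x = e i0" by auto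
    show ?case
      using F
    proof (induction rule: standard_maps_induct)
      case zero
      show ?case by (simp add: standard_maps_zero)
    next
      case (add F G)
      then show ?case using standard_maps_add by (fastforce simp: distrib_right)
    next
      case (scale r F)
      then show ?case by (simp add: scale_mult_left[symmetric] standard_maps_scale)
    next
      case (monomial k i)
      have "monomial (Suc n) (k(Suc n := k0)) (i(Suc n := i0)) \<in> standard_maps (Suc n)"
        using monomial k0 i0 by (intro monomial_in_standard_maps) (auto simp: PiE_iff extensional_def)
      also have "monomial (Suc n) (k(Suc n := k0)) (i(Suc n := i0))
          = (\<lambda>a. monomial n k i a * I k0 (a (Suc n)) * x)"
        unfolding monomial_def fun_eq_iff i0
        by (auto intro!: arg_cong[where f = "\<lambda>z. z * _ * _"] alternating_product_cong)
      finally show ?case .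
    qed
  qed
qed

text \<open>Arbitrary coefficients are allowed because the generation property supplies arbitrary
  \<open>p\<close> and \<open>q\<close>, not basis elements.\<close>

lemma alternating_product_in_standard_maps:
  assumes "k \<in> {1..n} \<rightarrow> K"
  shows "(\<lambda>a. alternating_product u (\<lambda>m. I (k m) (a m)) n) \<in> standard_maps n"
  using assms
proof (induction n)
  case 0
  show ?case by (simp add: const_in_standard_maps)
next
  case (Suc n)
  then have "k \<in> {1..n} \<rightarrow> K" "k (Suc n) \<in> K" by auto
  with Suc.IH show ?case by (simp add: standard_maps_extend)
qed

lemma alternating_product_last_linear_in_standard_maps:
  assumes k: "k \<in> {1..n} \<rightarrow> K" and g: "g \<in> linear_maps"
  shows "(\<lambda>a. alternating_product (u(n := g (a (Suc n)))) (\<lambda>m. I (k m) (a m)) n) \<in> standard_maps (Suc n)"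
proof -
  obtain ts where ts: "\<forall>(p, h, q)\<in>set ts. h \<in> I ` K"
    and g_eq: "\<And>x. g x = (\<Sum>(p, h, q)\<leftarrow>ts. p * h x * q)"
    using generates g unfolding generates_linear_maps_def by blast
  have "(\<lambda>a. alternating_product (u(n := (\<Sum>(p, h, q)\<leftarrow>ts. p * h (a (Suc n)) * q))) (\<lambda>m. I (k m) (a m)) n)
      \<in> standard_maps (Suc n)"
    using ts
  proof (induction ts)
    case Nil
    show ?case
      by (simp add: module_hom.zero[OF module_hom_alternating_product_last] standard_maps_zero del: fun_upd_apply)
  next
    case (Cons t ts)
    obtain p h q where t: "t = (p, h, q)" by (cases t)
    with Cons.prems obtain k0 where k0: "k0 \<in> K" "h = I k0" by auto
    \<comment> \<open>By associativity \<open>p\<close> stays as coefficient number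
      \<open>n\<close>, while \<open>x\<close> and \<open>q\<close> become the next mapping factor
      and the new last coefficient.\<close>
    have mult: "alternating_product (u(n := p * x * q)) v n = alternating_product (u(n := p)) v n * x * q"
      for x v
    proof (cases n)
      case (Suc m)
      have "alternating_product (u(n := y)) v m = alternating_product u v m" for y
        using Suc by (intro alternating_product_cong) auto
      with Suc show ?thesis by (simp add: mult.assoc)
    qed simp
    have "(\<lambda>a. alternating_product (u(n := p)) (\<lambda>m. I (k m) (a m)) n * I k0 (a (Suc n)) * q)
        \<in> standard_maps (Suc n)"
      by (intro standard_maps_extend alternating_product_in_standard_maps k k0)
    from standard_maps_add[OF this Cons.IH] Cons.prems show ?case
      by (simp add: t k0 module_hom.add[OF module_hom_alternating_product_last] mult del: fun_upd_apply)
  qed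
  then show ?thesis by (simp add: g_eq)
qed

text \<open>In a monomial the scalar is absorbed into the last basis element:
  \<open>x \<mapsto> \<phi> x *s e (i n)\<close> maps \<open>A\<close> linearly to \<open>A\<close>,
  so it is generated by the \<open>I k\<close>. No unit of \<open>A\<close> is involved.\<close>

lemma functional_mult_in_standard_maps:
  assumes F: "F \<in> standard_maps n" and \<phi>: "module_hom (*s) (*) \<phi>"
  shows "(\<lambda>a. \<phi> (a (Suc n)) *s F a) \<in> standard_maps (Suc n)"
  using F
proof (induction rule: standard_maps_induct)
  case zero
  show ?case by (simp add: standard_maps_zero)
next
  case (add F G)
  then show ?case using standard_maps_add by (fastforce simp: scale_right_distrib)
next
  case (scale r F)
  then show ?case using standard_maps_scale[OF scale, of r] by (simp add: mult.commute)
next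
  case (monomial k i)
  define u where "u = (\<lambda>j. e (i j))"
  interpret \<phi>: module_hom "(*s)" "(*)" \<phi> by (fact \<phi>)
  have "(\<lambda>x. \<phi> x *s u n) \<in> linear_maps"
    by (simp add: linear_maps_def module_hom_iff module_axioms \<phi>.add \<phi>.scale scale_left_distrib)
  with monomial
  have "(\<lambda>a. alternating_product (u(n := \<phi> (a (Suc n)) *s u n)) (\<lambda>m. I (k m) (a m)) n) \<in> standard_maps (Suc n)"
    by (intro alternating_product_last_linear_in_standard_maps) (auto simp: PiE_iff)
  then show ?case
    by (simp add: module_hom.scale[OF module_hom_alternating_product_last] monomial_def flip: u_def)
qed

section \<open>Expansion of polylinear mappings along a finite basis\<close>

lemma polylinear_fix_last:
  assumes "polylinear (Suc n) f"
  shows "polylinear n (\<lambda>a. f (a(Suc n := b)))"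
  unfolding polylinear_def
proof safe
  fix a :: "nat \<Rightarrow> 'a" and m
  assume a: "a \<in> {1..n} \<rightarrow>\<^sub>E UNIV" and m: "m \<in> {1..n}"
  have "a(Suc n := b) \<in> {1..Suc n} \<rightarrow>\<^sub>E UNIV"
    using a by (auto simp: PiE_iff extensional_def)
  with assms m have "(\<lambda>x. f (a(Suc n := b, m := x))) \<in> linear_maps"
    unfolding polylinear_def by auto
  then show "(\<lambda>x. f (a(m := x, Suc n := b))) \<in> linear_maps"
    using m by (simp add: fun_upd_twist)
qed

text \<open>\<open>restrict\<close> is there because \<open>polylinear\<close> constrains
  \<open>f\<close> only on extensional tuples, while \<open>standard_maps\<close> contains functions
  of all sequences.\<close>

lemma polylinear_in_standard_maps:
  assumes B: "finite B" "is_basis B"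
  shows "polylinear n f \<Longrightarrow> (\<lambda>a. f (restrict a {1..n})) \<in> standard_maps n"
proof (induction n arbitrary: f)
  case 0
  \<comment> \<open>Restriction to the empty set \<open>{1..0}\<close> forgets \<open>a\<close>, so
    the mapping is constant.\<close>
  show ?case by (simp add: const_in_standard_maps)
next
  case (Suc n)
  have indep: "independent B" and span: "span B = UNIV"
    using B by (auto simp: is_basis_def)
  have coord: "module_hom (*s) (*) (\<lambda>x. representation B x b)" for b
    unfolding module_hom_iff using module_axioms
    by (auto simp: representation_add representation_scale indep span module_def algebra_simps)
  have "(\<lambda>a. \<Sum>b\<in>B. representation B (a (Suc n)) b *s f ((restrict a {1..n})(Suc n := b))) \<in> standard_maps (Suc n)"
    by (intro standard_maps_sum functional_mult_in_standard_maps coord Suc.IH polylinear_fix_last Suc.prems)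
  also have "(\<lambda>a. \<Sum>b\<in>B. representation B (a (Suc n)) b *s f ((restrict a {1..n})(Suc n := b)))
      = (\<lambda>a. f (restrict a {1..Suc n}))"
  proof
    fix a :: "nat \<Rightarrow> 'a"
    let ?a = "restrict a {1..n}"
    let ?g = "\<lambda>x. f (?a(Suc n := x))"
    have "(\<lambda>x. f ((restrict a {1..Suc n})(Suc n := x))) \<in> linear_maps"
      using Suc.prems unfolding polylinear_def by auto
    moreover have upd: "(restrict a {1..Suc n})(Suc n := x) = ?a(Suc n := x)" for x
      by (auto simp: fun_eq_iff)
    ultimately interpret g: module_hom "(*s)" "(*s)" ?g
      by (simp add: linear_maps_def)
    have "(\<Sum>b\<in>B. representation B (a (Suc n)) b *s ?g b) = ?g (\<Sum>b\<in>B. representation B (a (Suc n)) b *s b)"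
      by (simp only: g.sum g.scale)
    also have "\<dots> = ?g (a (Suc n))"
      using sum_representation_eq[OF indep _ B(1) order_refl, of "a (Suc n)"] by (simp add: span)
    also have "?a(Suc n := a (Suc n)) = restrict a {1..Suc n}"
      by (auto simp: fun_eq_iff)
    finally show "(\<Sum>b\<in>B. representation B (a (Suc n)) b *s ?g b) = f (restrict a {1..Suc n})" .
  qed
  finally show ?case .
qed

lemma standard_representation_of_standard_map:
  assumes F: "F \<in> standard_maps n" and f: "\<And>a. a \<in> {1..n} \<rightarrow>\<^sub>E UNIV \<Longrightarrow> f a = F a"
  shows "\<exists>c. standard_representation n I K e N f c"
proof -
  define X where "X = ({1..n} \<rightarrow>\<^sub>E K) \<times> ({0..n} \<rightarrow>\<^sub>E N)"
  from F obtain t r where t: "finite t" "t \<subseteq> (\<lambda>(k, i). monomial n k i) ` X"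
    and F_eq: "F = (\<Sum>G\<in>t. (\<lambda>a. r G *s G a))"
    unfolding standard_maps_def monomials_def X_def pointwise.span_explicit by blast
  \<comment> \<open>Different index pairs may give the same function; \<open>S\<close> selects
    exactly one pair for each member of \<open>t\<close>, so that no coefficient is counted
    twice.\<close>
  obtain S where S: "S \<subseteq> X" "inj_on (\<lambda>(k, i). monomial n k i) S" "t = (\<lambda>(k, i). monomial n k i) ` S"
    using t(2) by (auto simp: subset_image_inj)
  have "finite S" using t(1) S(2,3) finite_imageD by blast
  define c where "c \<sigma> k i = (if \<sigma> = id \<and> (k, i) \<in> S then r (monomial n k i) else 0)"
    for \<sigma> :: "nat \<Rightarrow> nat" and k i
  define C where "C = {(\<sigma>, k, i) \<in> component_indices n K N. c \<sigma> k i \<noteq> 0}"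
  have C: "C \<subseteq> Pair id ` S" by (auto simp: C_def c_def split: if_splits)
  have S_C: "p \<in> Pair id ` S \<Longrightarrow> p \<in> component_indices n K N" for p
    using S(1) by (auto simp: component_indices_def X_def permutes_id)
  have "f a = (\<Sum>(\<sigma>, k, i)\<in>C. c \<sigma> k i *s
          alternating_product (\<lambda>j. e (i j)) (\<lambda>m. I (k (\<sigma> m)) (a (\<sigma> m))) n)"
    if "a \<in> {1..n} \<rightarrow>\<^sub>E UNIV" for a
  proof -
    have sum_apply: "(\<Sum>G\<in>t. (\<lambda>a. r G *s G a)) a = (\<Sum>G\<in>t. r G *s G a)"
      by (induction t rule: infinite_finite_induct) auto
    have "f a = (\<Sum>G\<in>t. r G *s G a)" using f[OF that] F_eq sum_apply by simp
    also have "\<dots> = (\<Sum>(k, i)\<in>S. r (monomial n k i) *s monomial n k i a)"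
      unfolding S(3) by (subst sum.reindex[OF S(2)]) (auto intro!: sum.cong)
    also have "\<dots> = (\<Sum>(\<sigma>, k, i)\<in>Pair id ` S. c \<sigma> k i *s
          alternating_product (\<lambda>j. e (i j)) (\<lambda>m. I (k (\<sigma> m)) (a (\<sigma> m))) n)"
      by (subst sum.reindex) (auto simp: inj_on_def c_def monomial_def intro!: sum.cong)
    also have "\<dots> = (\<Sum>(\<sigma>, k, i)\<in>C. c \<sigma> k i *s
          alternating_product (\<lambda>j. e (i j)) (\<lambda>m. I (k (\<sigma> m)) (a (\<sigma> m))) n)"
      \<comment> \<open>Pairs in \<open>S\<close> whose coefficient \<open>r\<close> vanishes lie
        outside the support \<open>C\<close> and contribute zero.\<close>
      using C S_C \<open>finite S\<close> by (intro sum.mono_neutral_right) (auto simp: C_def)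
    finally show ?thesis .
  qed
  moreover have "finite C" using C \<open>finite S\<close> finite_subset by blast
  ultimately show ?thesis
    unfolding standard_representation_def C_def by blast
qed

end

theorem theorem6p1:
  fixes scale :: "'d::comm_ring_1 \<Rightarrow> 'a::ring \<Rightarrow> 'a"
    and I :: "'k \<Rightarrow> 'a \<Rightarrow> 'a" and K :: "'k set"
    and e :: "'i \<Rightarrow> 'a" and N :: "'i set"
    and n :: nat and f :: "(nat \<Rightarrow> 'a) \<Rightarrow> 'a"
  assumes "assoc_algebra scale"
    and "assoc_algebra.free_finite_dimensional scale"
    and "inj_on I K" and "assoc_algebra.is_representation_basis scale (I ` K)"
    and "inj_on e N" and "assoc_algebra.is_basis scale (e ` N)"
    and "assoc_algebra.polylinear scale n f"
  shows "\<exists>c. assoc_algebra.standard_representation scale n I K e N f c"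
proof -
  interpret assoc_algebra scale by fact
  interpret generated_assoc_algebra scale I K e N
    using assms(4,6) by unfold_locales (auto simp: is_representation_basis_def is_basis_def)
  \<comment> \<open>\<open>B\<close> serves only to expand the arguments of \<open>f\<close>; the
    coefficients of the representation are still taken from \<open>e\<close>.\<close>
  obtain B where B: "finite B" "is_basis B"
    using assms(2) by (auto simp: free_finite_dimensional_def)
  from polylinear_in_standard_maps[OF B assms(7)] show ?thesis
    by (rule standard_representation_of_standard_map) (simp add: PiE_restrict)
qed

end
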